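(* Let $\Delta\ge 3$. There is a probability distribution over incremental (insertion-only) update sequences on forests of maximum degree at most $\Delta$, chosen obliviously (independently of the algorithm's randomness), such that every algorithm (deterministic or randomized) that maintains a proper $\Delta$-edge-coloring has expected amortized recourse $\Omega(1/\Delta)$.
   Context: A dynamic forest on a fixed vertex set starts empty; in the incremental model each update inserts an edge joining two distinct trees; the maximum degree stays at most $\Delta$. An algorithm must maintain after each update a proper edge coloring with palette $[\Delta]$. The recourse of an update is the number of previously colored edges whose color changes (coloring the new edge does not count). Expected amortized recourse is the expectation of the total recourse divided by the number of updates. *)

theory Defs
  imports "HOL-Probability.Probability"
begin

type_synonym 'v edge = "'v set"

definition adj :: "'v edge set \<Rightarrow> 'v rel" where
  "adj E = {(u, v). {u, v} \<in> E}"

definition deg :: "'v edge set \<Rightarrow> 'v \<Rightarrow> nat" where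
  "deg E v = card {e \<in> E. v \<in> e}"

text \<open>
  Incremental update sequences on the vertex set \<open>V\<close>, listed in order of insertion, starting from
  the empty forest. The trees are the classes of the reflexive transitive closure of adjacency;
  as it is reflexive, the endpoints of the inserted edge are distinct, and every intermediate
  graph is a forest.
\<close>

inductive incremental_forest :: "'v set \<Rightarrow> nat \<Rightarrow> 'v edge list \<Rightarrow> bool"
  for V :: "'v set" and \<Delta> :: nat where
  empty: "incremental_forest V \<Delta> []"
| insert_edge:
    "\<lbrakk> incremental_forest V \<Delta> es; u \<in> V; v \<in> V; (u, v) \<notin> (adj (set es))\<^sup>*;
       \<forall>w\<in>V. deg (set (es @ [{u, v}])) w \<le> \<Delta> \<rbrakk>
     \<Longrightarrow> incremental_forest V \<Delta> (es @ [{u, v}])"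

definition proper_edge_coloring :: "nat \<Rightarrow> 'v edge set \<Rightarrow> ('v edge \<Rightarrow> nat) \<Rightarrow> bool" where
  "proper_edge_coloring \<Delta> E c \<longleftrightarrow>
     (\<forall>e\<in>E. c e \<in> {1..\<Delta>}) \<and>
     (\<forall>e\<in>E. \<forall>f\<in>E. e \<noteq> f \<and> e \<inter> f \<noteq> {} \<longrightarrow> c e \<noteq> c f)"

text \<open>
  A deterministic online algorithm maps the updates seen so far to its current coloring; only the
  values on the edges inserted so far are meaningful.
\<close>

type_synonym 'v algorithm = "'v edge list \<Rightarrow> 'v edge \<Rightarrow> nat"

definition maintains_coloring :: "'v set \<Rightarrow> nat \<Rightarrow> 'v algorithm \<Rightarrow> bool" where
  "maintains_coloring V \<Delta> A \<longleftrightarrow>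
     (\<forall>es. incremental_forest V \<Delta> es \<longrightarrow> proper_edge_coloring \<Delta> (set es) (A es))"

definition recourse :: "'v algorithm \<Rightarrow> 'v edge list \<Rightarrow> 'v edge \<Rightarrow> nat" where
  "recourse A es e = card {f \<in> set es. A (es @ [e]) f \<noteq> A es f}"

definition total_recourse :: "'v algorithm \<Rightarrow> 'v edge list \<Rightarrow> nat" where
  "total_recourse A es = (\<Sum>i<length es. recourse A (take i es) (es ! i))"

text \<open>
  A randomized algorithm is a probability measure on deterministic algorithms: once its random
  seed is fixed, an algorithm is deterministic, and the measure is the image of the law of the
  seed. Measurability says that each color it displays is a random variable. Correctness is only
  required almost surely.
\<close>

definition randomized_algorithm :: "'v set \<Rightarrow> nat \<Rightarrow> 'v algorithm measure \<Rightarrow> bool" where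
  "randomized_algorithm V \<Delta> M \<longleftrightarrow>
     prob_space M \<and>
     (\<forall>es e. (\<lambda>A. A es e) \<in> M \<rightarrow>\<^sub>M count_space UNIV) \<and>
     (AE A in M. maintains_coloring V \<Delta> A)"

text \<open>
  The update sequence is drawn from \<open>D\<close> obliviously: \<open>M\<close> in the inner expectation does not depend
  on \<open>es\<close>, which is independence of the sequence from the randomness of the algorithm.
\<close>

definition expected_amortized_recourse ::
    "'v edge list pmf \<Rightarrow> 'v algorithm measure \<Rightarrow> real" where
  "expected_amortized_recourse D M =
     measure_pmf.expectation D
       (\<lambda>es. \<integral>A. real (total_recourse A es) / real (length es) \<partial>M)"

text \<open>Deterministic algorithms are the point masses.\<close>

lemma randomized_algorithm_return:
  assumes "maintains_coloring V \<Delta> A"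
  shows "randomized_algorithm V \<Delta> (return (count_space UNIV) A)"
  using assms unfolding randomized_algorithm_def
  by (auto intro!: prob_space_return simp: AE_return)

lemma expected_amortized_recourse_return:
  "expected_amortized_recourse D (return (count_space UNIV) A) =
     measure_pmf.expectation D (\<lambda>es. real (total_recourse A es) / real (length es))"
  unfolding expected_amortized_recourse_def by (simp add: integral_return)

end

theory Submission
  imports Defs
begin

text \<open>
  Build \<open>m\<close> disjoint pairs of stars with \<open>\<Delta> - 1\<close> leaves each, and then toss a single coin: either
  the two centers of every pair are joined by an edge, or they are both joined to a third vertex.
  A proper coloring makes the two centers of a pair miss the same color in the first case and
  different colors in the second, so the final colorings of the two outcomes disagree on a star
  edge of each pair. Both outcomes start from the same coloring of the stars, so by the triangle
  inequality for the Hamming distance the recourses of the two outcomes add up to at least \<open>m\<close>,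
  whereas only \<open>O(m \<Delta>)\<close> edges are inserted.
\<close>

section \<open>Recourse\<close>

lemma total_recourse_snoc:
  "total_recourse A (es @ [e]) = total_recourse A es + recourse A es e"
proof -
  have "(\<Sum>i<length es. recourse A (take i (es @ [e])) ((es @ [e]) ! i)) = total_recourse A es"
    unfolding total_recourse_def by (intro sum.cong) (auto simp: nth_append)
  then show ?thesis
    unfolding total_recourse_def[of A "es @ [e]"] by simp
qed

text \<open>Triangle inequality for the Hamming distance, one update at a time: an edge of
  \<open>es\<close> whose color changed in the end was recolored by some update in
  \<open>es'\<close>. The recourse incurred during \<open>es\<close> itself is simply
  dropped.\<close>

lemma card_recolored_le_total_recourse:
  "card {f \<in> set es. A (es @ es') f \<noteq> A es f} \<le> total_recourse A (es @ es')"
proof (induction es' rule: rev_induct)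
  case Nil
  then show ?case by simp
next
  case (snoc e es')
  let ?l = "es @ es'"
  have "{f \<in> set es. A (?l @ [e]) f \<noteq> A es f} \<subseteq>
      {f \<in> set es. A ?l f \<noteq> A es f} \<union> {f \<in> set ?l. A (?l @ [e]) f \<noteq> A ?l f}"
    by auto
  then have "card {f \<in> set es. A (?l @ [e]) f \<noteq> A es f} \<le>
      card ({f \<in> set es. A ?l f \<noteq> A es f} \<union> {f \<in> set ?l. A (?l @ [e]) f \<noteq> A ?l f})"
    by (intro card_mono) auto
  also have "\<dots> \<le> card {f \<in> set es. A ?l f \<noteq> A es f} + recourse A ?l e"
    unfolding recourse_def by (rule card_Un_le)
  also have "\<dots> \<le> total_recourse A (?l @ [e])"
    unfolding total_recourse_snoc using snoc.IH by simp
  finally show ?case by simp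
qed

text \<open>After the common prefix \<open>es\<close> a deterministic algorithm shows the same
  coloring \<open>A es\<close> in both futures; an edge on which the futures disagree has left that
  color in at least one of them.\<close>

lemma card_disagreement_le_total_recourse:
  "card {f \<in> set es. A (es @ es1) f \<noteq> A (es @ es2) f}
     \<le> total_recourse A (es @ es1) + total_recourse A (es @ es2)"
proof -
  have "{f \<in> set es. A (es @ es1) f \<noteq> A (es @ es2) f} \<subseteq>
      {f \<in> set es. A (es @ es1) f \<noteq> A es f} \<union> {f \<in> set es. A (es @ es2) f \<noteq> A es f}"
    by auto
  then have "card {f \<in> set es. A (es @ es1) f \<noteq> A (es @ es2) f} \<le>
      card ({f \<in> set es. A (es @ es1) f \<noteq> A es f} \<union> {f \<in> set es. A (es @ es2) f \<noteq> A es f})"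
    by (intro card_mono) auto
  also have "\<dots> \<le> card {f \<in> set es. A (es @ es1) f \<noteq> A es f} +
      card {f \<in> set es. A (es @ es2) f \<noteq> A es f}"
    by (rule card_Un_le)
  also have "\<dots> \<le> total_recourse A (es @ es1) + total_recourse A (es @ es2)"
    by (intro add_mono card_recolored_le_total_recourse)
  finally show ?thesis .
qed

section \<open>Integrability of the recourse and averaging over the coin\<close>

lemma recourse_le: "recourse A es e \<le> length es"
proof -
  have "recourse A es e \<le> card (set es)"
    unfolding recourse_def by (intro card_mono) auto
  also have "\<dots> \<le> length es" by (rule card_length)
  finally show ?thesis .
qed

text \<open>A crude bound that does not depend on \<open>A\<close>, so that the recourse is a
  bounded random variable.\<close>

lemma total_recourse_le: "total_recourse A es \<le> length es * length es"
proof -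
  have "total_recourse A es \<le> (\<Sum>i<length es. length es)"
    unfolding total_recourse_def
    by (intro sum_mono order_trans[OF recourse_le]) simp
  then show ?thesis by simp
qed

text \<open>The recourse is a finite sum of indicators that two displayed colors differ, and each
  displayed color is a random variable.\<close>

lemma measurable_total_recourse:
  assumes "randomized_algorithm V \<Delta> M"
  shows "(\<lambda>A. real (total_recourse A es)) \<in> borel_measurable M"
proof -
  have meas [measurable]: "(\<lambda>A. A es e) \<in> M \<rightarrow>\<^sub>M count_space UNIV" for es e
    using assms by (simp add: randomized_algorithm_def)
  have "real (recourse A es e) = (\<Sum>f\<in>set es. if A (es @ [e]) f = A es f then 0 else 1)"
    for A es and e :: "'a edge"
  proof -
    have "(\<Sum>f\<in>set es. if A (es @ [e]) f = A es f then 0 else 1 :: real) =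
        (\<Sum>f\<in>{f \<in> set es. A (es @ [e]) f \<noteq> A es f}. 1)"
      by (intro sum.mono_neutral_cong_right) auto
    then show ?thesis by (simp add: recourse_def)
  qed
  then have "(\<lambda>A. real (total_recourse A es)) = (\<lambda>A. \<Sum>i<length es. \<Sum>f\<in>set (take i es).
      if A (take i es @ [es ! i]) f = A (take i es) f then 0 else 1)"
    by (simp add: total_recourse_def)
  also have "\<dots> \<in> borel_measurable M"
    by measurable
  finally show ?thesis .
qed

lemma integrable_total_recourse:
  assumes "randomized_algorithm V \<Delta> M"
  shows "integrable M (\<lambda>A. real (total_recourse A es))"
proof -
  interpret prob_space M
    using assms by (simp add: randomized_algorithm_def)
  have "norm (real (total_recourse A es)) \<le> real (length es * length es)" for A
    by (simp only: real_norm_def abs_of_nat of_nat_le_iff total_recourse_le)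
  then show ?thesis
    by (intro integrable_const_bound measurable_total_recourse[OF assms] AE_I2)
qed

text \<open>The form of Yao's principle used here: for almost every fixed algorithm the recourses of
  the two outcomes add up to at least \<open>k\<close>, so their expectations do as well, and the
  fair coin averages them.\<close>

lemma expected_amortized_recourse_coin_ge:
  fixes L k :: nat
  assumes M: "randomized_algorithm V \<Delta> M" and L: "L > 0"
    and len: "\<And>b. 0 < length (es b)" "\<And>b. length (es b) \<le> L"
    and sum: "\<And>A. maintains_coloring V \<Delta> A \<Longrightarrow>
      k \<le> total_recourse A (es True) + total_recourse A (es False)"
  shows "real k / (2 * real L) \<le> expected_amortized_recourse (map_pmf es (bernoulli_pmf (1/2))) M"
proof -
  interpret prob_space M
    using M by (simp add: randomized_algorithm_def)
  let ?T = "\<lambda>b A. real (total_recourse A (es b))"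
  let ?I = "\<lambda>b. \<integral>A. ?T b A \<partial>M"
  note int = integrable_total_recourse[OF M]
  have "(\<integral>A. real k \<partial>M) \<le> (\<integral>A. ?T True A + ?T False A \<partial>M)"
  proof (rule integral_mono_AE)
    have "AE A in M. maintains_coloring V \<Delta> A"
      using M by (simp add: randomized_algorithm_def)
    then show "AE A in M. real k \<le> ?T True A + ?T False A"
      by eventually_elim (use sum in \<open>simp flip: of_nat_add\<close>)
  qed (use int in auto)
  then have k: "real k \<le> ?I True + ?I False"
    using int by (simp add: prob_space)
  \<comment> \<open>The two outcomes may differ in length; replacing both lengths by the common
    bound \<open>L\<close> only lowers the quotients.\<close>
  have le: "?I b / L \<le> ?I b / length (es b)" for b
    using len[of b] by (intro divide_left_mono integral_nonneg) (auto simp: L)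
  have "real k / (2 * real L) \<le> (?I True / L + ?I False / L) / 2"
    using k L by (simp add: field_simps)
  also have "\<dots> \<le> (?I True / length (es True) + ?I False / length (es False)) / 2"
    by (intro divide_right_mono add_mono le) simp
  also have "\<dots> = expected_amortized_recourse (map_pmf es (bernoulli_pmf (1/2))) M"
    by (simp add: expected_amortized_recourse_def add_divide_distrib)
  finally show ?thesis .
qed

section \<open>Forests given by a parent function\<close>

lemma deg_mono: "finite F \<Longrightarrow> E \<subseteq> F \<Longrightarrow> deg E v \<le> deg F v"
  unfolding deg_def by (intro card_mono) auto

text \<open>Since \<open>x\<close> is not in \<open>X\<close>, it is a root of the current forest.
  Every vertex connected to \<open>x\<close> therefore reaches \<open>x\<close> along parent
  pointers, and these decrease, so it is at least \<open>x\<close>; but \<open>par x\<close> is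
  smaller.\<close>

lemma parent_not_connected:
  fixes par :: "'v::linorder \<Rightarrow> 'v"
  assumes dec: "\<And>y. y \<in> X \<Longrightarrow> par y < y" and x: "x \<notin> X" "par x < x"
  shows "(x, par x) \<notin> (adj ((\<lambda>y. {y, par y}) ` X))\<^sup>*"
proof
  let ?R = "{(y, par y) |y. y \<in> X}"
  assume "(x, par x) \<in> (adj ((\<lambda>y. {y, par y}) ` X))\<^sup>*"
  then have "(par x, x) \<in> ?R\<^sup>*"
  proof (induction rule: rtrancl_induct)
    case base
    show ?case by simp
  next
    case (step y z)
    from step.hyps(2) obtain a where a: "a \<in> X" "{y, z} = {a, par a}"
      by (auto simp: adj_def)
    then consider "a = z" "y = par z" | "a = y" "z = par y"
      by (auto simp: doubleton_eq_iff)
    then show ?case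
    proof cases
      case 1
      with a have "(z, y) \<in> ?R" by auto
      with step.IH show ?thesis by (rule converse_rtrancl_into_rtrancl[rotated])
    next
      case 2
      \<comment> \<open>The step goes up from \<open>y\<close> to its parent. As \<open>y\<close> is
        not the root \<open>x\<close>, the chain from \<open>y\<close> to \<open>x\<close> has a
        first arrow, which must be the one to \<open>par y\<close>.\<close>
      with a x have "y \<noteq> x" by auto
      from step.IH show ?thesis
      proof (cases rule: converse_rtranclE)
        case base
        with \<open>y \<noteq> x\<close> show ?thesis by contradiction
      next
        case (step w)
        with 2 show ?thesis by auto
      qed
    qed
  qed
  moreover have "x \<le> y" if "(y, x) \<in> ?R\<^sup>*" for y
    using that by (induction rule: converse_rtrancl_induct) (use dec in force)+
  ultimately show False using x(2) by (meson leD)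
qed

text \<open>Any insertion order is valid, because the next child is always still a root. Degrees
  only grow, so bounding them in the final graph is enough.\<close>

lemma incremental_forest_parent:
  fixes par :: "'v::linorder \<Rightarrow> 'v"
  assumes "distinct xs"
    and "\<And>x. x \<in> set xs \<Longrightarrow> par x < x \<and> x \<in> V \<and> par x \<in> V"
    and "\<And>v. v \<in> V \<Longrightarrow> deg ((\<lambda>x. {x, par x}) ` set xs) v \<le> \<Delta>"
  shows "incremental_forest V \<Delta> (map (\<lambda>x. {x, par x}) xs)"
  using assms
proof (induction xs rule: rev_induct)
  case Nil
  show ?case by (simp add: incremental_forest.empty)
next
  case (snoc x xs)
  let ?f = "\<lambda>x. {x, par x}"
  have "deg (?f ` set xs) v \<le> \<Delta>" if "v \<in> V" for v
    using snoc.prems(3)[OF that] by (rule order_trans[OF deg_mono, rotated -1]) auto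
  then have IH: "incremental_forest V \<Delta> (map ?f xs)"
    using snoc.prems by (intro snoc.IH) auto
  have "incremental_forest V \<Delta> (map ?f xs @ [{x, par x}])"
  proof (rule incremental_forest.insert_edge[OF IH])
    show "(x, par x) \<notin> (adj (set (map ?f xs)))\<^sup>*"
      unfolding set_map using snoc.prems by (intro parent_not_connected) auto
    show "\<forall>w\<in>V. deg (set (map ?f xs @ [{x, par x}])) w \<le> \<Delta>"
      using snoc.prems(3) by simp
  qed (use snoc.prems in auto)
  then show ?case by simp
qed

section \<open>The random instance\<close>

text \<open>
  The vertices are split into blocks of \<open>2 * \<Delta> + 1\<close> consecutive numbers. In each block, the
  vertices \<open>1\<close> and \<open>2\<close> are the centers of the two stars, their leaves are the odd and the even
  numbers from \<open>3\<close> on. With \<open>q = 1\<close> the center \<open>2\<close> is attached to \<open>1\<close>; with \<open>q = 0\<close> both centers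
  are attached to \<open>0\<close>.
\<close>

definition parent :: "nat \<Rightarrow> nat \<Rightarrow> nat \<Rightarrow> nat" where
  "parent B q x =
     B * (x div B) + (if x mod B < 3 then q else if odd (x mod B) then 1 else 2)"

definition stars :: "nat \<Rightarrow> nat \<Rightarrow> nat edge list" where
  "stars B m = map (\<lambda>x. {x, parent B 0 x}) (filter (\<lambda>x. 3 \<le> x mod B) [0..<B * m])"

text \<open>The vertex \<open>q\<close> is the root of its block: the condition
  \<open>q < x mod B\<close> picks only the center 2 for \<open>q = 1\<close> (leaving vertex 0
  isolated), and both centers for \<open>q = 0\<close>.\<close>

definition links :: "nat \<Rightarrow> nat \<Rightarrow> nat \<Rightarrow> nat edge list" where
  "links B m q =
     map (\<lambda>x. {x, parent B q x}) (filter (\<lambda>x. q < x mod B \<and> x mod B < 3) [0..<B * m])"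

text \<open>The parent of a leaf does not depend on \<open>q\<close>. Hence both outcomes share the
  prefix \<open>stars B m\<close>, and yet each is given by a single parent function.\<close>

lemma stars_links_eq_map:
  "stars B m @ links B m q = map (\<lambda>x. {x, parent B q x})
     (filter (\<lambda>x. 3 \<le> x mod B) [0..<B * m] @
      filter (\<lambda>x. q < x mod B \<and> x mod B < 3) [0..<B * m])"
proof -
  have "parent B 0 x = parent B q x" if "3 \<le> x mod B" for x
    using that by (simp add: parent_def)
  then have "stars B m = map (\<lambda>x. {x, parent B q x}) (filter (\<lambda>x. 3 \<le> x mod B) [0..<B * m])"
    unfolding stars_def by (intro map_cong) auto
  then show ?thesis
    unfolding links_def map_append by (rule arg_cong)
qed

lemma set_stars_links:
  assumes "q \<le> 1"
  shows "set (stars B m @ links B m q) = (\<lambda>x. {x, parent B q x}) ` {x. x < B * m \<and> q < x mod B}"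
  using assms unfolding stars_links_eq_map by force

lemma length_stars_links_le: "length (stars B m @ links B m q) \<le> B * m"
proof -
  let ?xs = "[0..<B * m]"
  have "length (stars B m @ links B m q) \<le> length (filter (\<lambda>x. 3 \<le> x mod B) ?xs) +
      length (filter (\<lambda>x. \<not> 3 \<le> x mod B) ?xs)"
    by (simp add: stars_def links_def) (auto simp: length_filter_conv_card intro!: card_mono)
  also have "\<dots> = B * m" by (simp only: sum_length_filter_compl length_upt diff_zero)
  finally show ?thesis .
qed

text \<open>Vertex 3 of each block contributes an edge. This makes the sequences nonempty and as
  long as desired.\<close>

lemma length_stars_ge:
  assumes "B > 3"
  shows "m \<le> length (stars B m)"
proof -
  have "(\<lambda>j. B * j + 3) ` {..<m} \<subseteq> {x. x < B * m \<and> 3 \<le> x mod B}"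
  proof clarify
    fix j assume "j < m"
    then have "B * Suc j \<le> B * m" by (intro mult_le_mono2) simp
    with assms show "B * j + 3 < B * m \<and> 3 \<le> (B * j + 3) mod B" by simp
  qed
  then have "card ((\<lambda>j. B * j + 3) ` {..<m}) \<le> card {x. x < B * m \<and> 3 \<le> x mod B}"
    by (intro card_mono) auto
  moreover have "card ((\<lambda>j. B * j + 3) ` {..<m}) = m"
    using assms by (subst card_image) (auto simp: inj_on_def)
  moreover have "length (stars B m) = card {x. x < B * m \<and> 3 \<le> x mod B}"
    by (auto simp: stars_def length_filter_conv_card intro!: arg_cong[where f = card])
  ultimately show ?thesis by simp
qed

section \<open>Acyclicity and degree bound of the random instance\<close>

lemma parent_less:
  assumes "q < x mod B"
  shows "parent B q x < x"
proof -
  have "(if x mod B < 3 then q else if odd (x mod B) then 1 else 2) < x mod B"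
    using assms by auto
  then have "parent B q x < B * (x div B) + x mod B"
    by (simp only: parent_def nat_add_left_cancel_less)
  then show ?thesis by simp
qed

lemma parent_block:
  assumes "r < B"
  shows "parent B q (B * j + r) = B * j + (if r < 3 then q else if odd r then 1 else 2)"
  using assms by (simp add: parent_def)

lemma parent_div_mod:
  assumes "q \<le> 1" "B > 3"
  shows "parent B q x div B = x div B"
    and "parent B q x mod B = (if x mod B < 3 then q else if odd (x mod B) then 1 else 2)"
  using assms by (simp_all add: parent_def)

text \<open>An edge of a block is named by the residue \<open>r\<close> of its child; it touches
  \<open>s\<close> if \<open>s\<close> is the child or the parent. In each case an explicit set
  covers these residues.\<close>

lemma card_incident_in_block:
  assumes "\<Delta> \<ge> 3" and "q \<le> 1"
  shows "card {r. q < r \<and> r < 2 * \<Delta> + 1 \<and>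
      (r = s \<or> (if r < 3 then q else if odd r then 1 else 2) = s)} \<le> \<Delta>" (is "card ?S \<le> _")
proof -
  have "\<exists>T. ?S \<subseteq> T \<and> finite T \<and> card T \<le> \<Delta>"
  proof -
    consider "s = 0" | "s = 1" "q = 0" | "s = 1" "q = 1" | "s = 2" | "s \<ge> 3"
      using assms by linarith
    then show ?thesis
    proof cases
      case 1
      have "?S \<subseteq> {1, 2}"
        using 1 by (auto split: if_splits)
      moreover have "card {1, 2 :: nat} \<le> \<Delta>" using assms by simp
      ultimately show ?thesis by blast
    next
      case 2
      \<comment> \<open>The residue 1 names the link from center 1 to vertex 0, and the remaining
        odd residues name the leaves.\<close>
      have "?S \<subseteq> (\<lambda>i. 2 * i + 1) ` {..<\<Delta>}"
        using 2 by (auto split: if_splits elim!: oddE)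
      moreover have "card ((\<lambda>i::nat. 2 * i + 1) ` {..<\<Delta>}) \<le> \<Delta>"
        using card_image_le[of "{..<\<Delta>}"] by simp
      ultimately show ?thesis by blast
    next
      case 3
      \<comment> \<open>Now the link is named by its child, center 2, next to the \<Delta> - 1 odd
        leaves.\<close>
      have "?S \<subseteq> insert 2 ((\<lambda>i. 2 * i + 1) ` {1..<\<Delta>})"
        using 3 by (auto split: if_splits elim!: oddE)
      moreover have "card (insert 2 ((\<lambda>i::nat. 2 * i + 1) ` {1..<\<Delta>})) \<le> Suc (\<Delta> - 1)"
        using card_image_le[of "{1..<\<Delta>}" "\<lambda>i::nat. 2 * i + 1"]
        using assms by (intro card_insert_le_m1) auto
      moreover have "Suc (\<Delta> - 1) = \<Delta>" using assms by simp
      ultimately show ?thesis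
        by (intro exI[of _ "insert 2 ((\<lambda>i. 2 * i + 1) ` {1..<\<Delta>})"]) simp
    next
      case 4
      have "?S \<subseteq> (\<lambda>i. 2 * i) ` {1..\<Delta>}"
      proof
        fix r assume r: "r \<in> ?S"
        then have "even r" using 4 assms by (auto split: if_splits)
        then obtain i where "r = 2 * i" by (elim evenE)
        with r show "r \<in> (\<lambda>i. 2 * i) ` {1..\<Delta>}" by auto
      qed
      moreover have "card ((\<lambda>i::nat. 2 * i) ` {1..\<Delta>}) \<le> \<Delta>"
        using card_image_le[of "{1..\<Delta>}"] by simp
      ultimately show ?thesis by blast
    next
      case 5
      have "?S \<subseteq> {s}"
        using 5 assms by (auto split: if_splits)
      moreover have "card {s} \<le> \<Delta>" using assms by simp
      ultimately show ?thesis by blast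
    qed
  qed
  then show ?thesis by (meson card_mono order_trans)
qed

lemma deg_stars_links_le:
  assumes "\<Delta> \<ge> 3" and "q \<le> 1" and B: "B = 2 * \<Delta> + 1"
  shows "deg (set (stars B m @ links B m q)) v \<le> \<Delta>"
proof -
  let ?p = "\<lambda>r. if r < 3 then q else if odd r then 1 else 2"
  let ?S = "{r. q < r \<and> r < B \<and> (r = v mod B \<or> ?p r = v mod B)}"
  let ?g = "\<lambda>r. {B * (v div B) + r, parent B q (B * (v div B) + r)}"
  have B3: "B > 3" using assms by simp
  have "{e \<in> set (stars B m @ links B m q). v \<in> e} \<subseteq> ?g ` ?S"
  proof
    fix e assume "e \<in> {e \<in> set (stars B m @ links B m q). v \<in> e}"
    then obtain x where x: "e = {x, parent B q x}" "q < x mod B" "v = x \<or> v = parent B q x"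
      unfolding set_stars_links[OF \<open>q \<le> 1\<close>] by auto
    have "v div B = x div B"
      using x(3) parent_div_mod(1)[OF \<open>q \<le> 1\<close> B3] by auto
    then have "e = ?g (x mod B)" using x(1) by simp
    moreover have "x mod B \<in> ?S"
      using x(2,3) B3 parent_div_mod(2)[OF \<open>q \<le> 1\<close> B3, of x] by auto
    ultimately show "e \<in> ?g ` ?S" by blast
  qed
  then have "deg (set (stars B m @ links B m q)) v \<le> card (?g ` ?S)"
    unfolding deg_def by (intro card_mono) auto
  also have "\<dots> \<le> card ?S"
    by (intro card_image_le) auto
  also have "\<dots> \<le> \<Delta>"
    unfolding B by (rule card_incident_in_block) fact+
  finally show ?thesis .
qed

lemma incremental_forest_stars_links:
  assumes "\<Delta> \<ge> 3" and "q \<le> 1" and "B = 2 * \<Delta> + 1"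
  shows "incremental_forest {..<B * m} \<Delta> (stars B m @ links B m q)"
  unfolding stars_links_eq_map
proof (rule incremental_forest_parent, goal_cases)
  case 1
  show ?case by auto
next
  case (2 x)
  then have "x < B * m" "q < x mod B"
    using \<open>q \<le> 1\<close> by auto
  with parent_less[of q x B] show ?case by auto
next
  case (3 v)
  show ?case
    using deg_stars_links_le[OF assms, of m v]
    by (simp only: stars_links_eq_map set_map)
qed

section \<open>Disagreement of the final colorings\<close>

lemma proper_edge_coloring_neq:
  "\<lbrakk>proper_edge_coloring \<Delta> E c; e \<in> E; f \<in> E; e \<noteq> f; v \<in> e; v \<in> f\<rbrakk> \<Longrightarrow> c e \<noteq> c f"
  unfolding proper_edge_coloring_def by blast

lemma proper_edge_coloring_range:
  "\<lbrakk>proper_edge_coloring \<Delta> E c; e \<in> E\<rbrakk> \<Longrightarrow> c e \<in> {1..\<Delta>}"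
  unfolding proper_edge_coloring_def by blast

text \<open>The \<Delta> edges of \<open>insert e F\<close> meet at \<open>v\<close>, so they use
  each color of the palette exactly once.\<close>

lemma color_image_star:
  assumes c: "proper_edge_coloring \<Delta> E c" and "\<Delta> > 0"
    and F: "F \<subseteq> E" "finite F" "card F = \<Delta> - 1" "\<And>f. f \<in> F \<Longrightarrow> v \<in> f"
    and e: "e \<in> E" "e \<notin> F" "v \<in> e"
  shows "c ` F = {1..\<Delta>} - {c e}"
proof (rule card_subset_eq)
  have neq: "c f \<noteq> c g" if "f \<in> insert e F" "g \<in> insert e F" "f \<noteq> g" for f g
    using that F e by (intro proper_edge_coloring_neq[OF c, where v = v]) auto
  have range: "c f \<in> {1..\<Delta>}" if "f \<in> E" for f
    using c that by (rule proper_edge_coloring_range)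
  show "finite ({1..\<Delta>} - {c e})" by simp
  show "c ` F \<subseteq> {1..\<Delta>} - {c e}"
    using neq range F e by blast
  have "inj_on c F"
    using neq by (meson inj_onI insertCI)
  then show "card (c ` F) = card ({1..\<Delta>} - {c e})"
    using F(3) range[OF e(1)] by (simp add: card_image card_Diff_singleton)
qed

text \<open>The star edges at the center \<open>s\<close> (\<open>s = 1\<close> or \<open>s = 2\<close>) of block \<open>j\<close>.\<close>

definition star :: "nat \<Rightarrow> nat \<Rightarrow> nat \<Rightarrow> nat edge set" where
  "star \<Delta> j s = (\<lambda>i. {(2 * \<Delta> + 1) * j + s, (2 * \<Delta> + 1) * j + (s + 2 + 2 * i)}) ` {..<\<Delta> - 1}"

lemma card_star: "card (star \<Delta> j s) = \<Delta> - 1"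
  unfolding star_def by (subst card_image) (auto simp: inj_on_def doubleton_eq_iff)

lemma block_vertex_less:
  assumes "j < m" and "r < B"
  shows "B * j + r < B * (m :: nat)"
proof -
  have "B * Suc j \<le> B * m" using assms(1) by (intro mult_le_mono2) simp
  with assms(2) show ?thesis by simp
qed

lemma star_subset_stars:
  assumes "j < m" and "s = 1 \<or> s = 2" and B: "B = 2 * \<Delta> + 1"
  shows "star \<Delta> j s \<subseteq> set (stars B m)"
proof
  fix f assume "f \<in> star \<Delta> j s"
  then obtain i where i: "i < \<Delta> - 1" "f = {B * j + s, B * j + (s + 2 + 2 * i)}"
    unfolding star_def B by auto
  let ?r = "s + 2 + 2 * i"
  have r: "?r < B" "3 \<le> ?r" using i assms by auto
  have "parent B 0 (B * j + ?r) = B * j + s"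
    using r assms(2) by (auto simp: parent_block simp del: add_Suc_right)
  then have "f = {B * j + ?r, parent B 0 (B * j + ?r)}"
    using i by auto
  moreover have "B * j + ?r < B * m" using assms(1) r(1) by (rule block_vertex_less)
  moreover have "(B * j + ?r) mod B = ?r" using r(1) by (simp only: mod_mult_self4 mod_less)
  ultimately show "f \<in> set (stars B m)"
    unfolding stars_def set_map using r(2)
    by (intro image_eqI[where x = "B * j + ?r"]) auto
qed

text \<open>The smaller endpoint of a star edge is its center, so the block can be read off the
  edge. This keeps disagreements in different blocks apart when they are counted.\<close>

lemma Min_star_div:
  assumes "f \<in> star \<Delta> j s" and "s = 1 \<or> s = 2"
  shows "Min f div (2 * \<Delta> + 1) = j"
proof -
  obtain i where i: "i < \<Delta> - 1"
    "f = {(2 * \<Delta> + 1) * j + s, (2 * \<Delta> + 1) * j + (s + 2 + 2 * i)}"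
    using assms(1) unfolding star_def by auto
  have "Min f = (2 * \<Delta> + 1) * j + s" using i(2) by simp
  moreover have "s < 2 * \<Delta> + 1" using i(1) assms(2) by auto
  ultimately show ?thesis by (simp only: div_mult_self4 div_less)
qed

lemma final_colorings_disagree:
  assumes \<Delta>: "\<Delta> \<ge> 3" and B: "B = 2 * \<Delta> + 1" and j: "j < m"
    and c1: "proper_edge_coloring \<Delta> (set (stars B m @ links B m 1)) c1"
    and c0: "proper_edge_coloring \<Delta> (set (stars B m @ links B m 0)) c0"
  shows "\<exists>f \<in> star \<Delta> j 1 \<union> star \<Delta> j 2. c1 f \<noteq> c0 f"
proof (rule ccontr)
  assume "\<not> ?thesis"
  then have eq: "c1 ` star \<Delta> j s = c0 ` star \<Delta> j s" if "s = 1 \<or> s = 2" for s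
    using that by (intro image_cong) auto
  have link: "{B * j + q, B * j + s} \<in> set (stars B m @ links B m q)"
    if "q \<le> 1" "q < s" "s < 3" for q s
  proof -
    have "s < B" using that \<Delta> B by simp
    then have "B * j + s < B * m" "parent B q (B * j + s) = B * j + q"
      using block_vertex_less[OF j] that by (auto simp: parent_block)
    then show ?thesis
      unfolding set_stars_links[OF that(1)] using that \<open>s < B\<close>
      by (intro image_eqI[where x = "B * j + s"]) auto
  qed
  \<comment> \<open>Here \<open>e\<close> is the link from parent \<open>q\<close> to child
    \<open>t\<close>, and \<open>s\<close> is an endpoint of it that is a center; with the link,
    this center has full degree \<Delta>.\<close>
  have image: "c ` star \<Delta> j s = {1..\<Delta>} - {c e}"
    if "proper_edge_coloring \<Delta> (set (stars B m @ links B m q)) c"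
      "s = 1 \<or> s = 2" "e = {B * j + q, B * j + t}" "q \<le> 1" "q < t" "t < 3" "s = q \<or> s = t"
    for c q s t e
  proof (rule color_image_star[OF that(1), where v = "B * j + s"])
    show "star \<Delta> j s \<subseteq> set (stars B m @ links B m q)"
      using star_subset_stars[OF j that(2) B] by auto
    show "e \<notin> star \<Delta> j s"
      using that(2-) unfolding star_def B by (auto simp: doubleton_eq_iff)
    show "e \<in> set (stars B m @ links B m q)"
      using link that by simp
  qed (use that \<Delta> B card_star in \<open>auto simp: star_def\<close>)
  let ?e = "{B * j + 1, B * j + 2}"
  let ?e1 = "{B * j + 0, B * j + 1}" and ?e2 = "{B * j + 0, B * j + 2}"
  \<comment> \<open>If the colorings agreed on both stars, the color missed at center 1 could be
    carried through the direct link \<open>?e\<close> to center 2, giving \<open>?e1\<close> and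
    \<open>?e2\<close> the same color although they meet at vertex 0.\<close>
  have "{1..\<Delta>} - {c0 ?e1} = c0 ` star \<Delta> j 1" by (rule image[OF c0, symmetric]) auto
  also have "\<dots> = {1..\<Delta>} - {c1 ?e}"
    by (subst eq[symmetric], simp, rule image[OF c1]) auto
  also have "\<dots> = c1 ` star \<Delta> j 2" by (rule image[OF c1, symmetric]) auto
  also have "\<dots> = {1..\<Delta>} - {c0 ?e2}"
    by (subst eq, simp, rule image[OF c0]) auto
  finally have same: "{1..\<Delta>} - {c0 ?e1} = {1..\<Delta>} - {c0 ?e2}" .
  have mem: "?e1 \<in> set (stars B m @ links B m 0)" "?e2 \<in> set (stars B m @ links B m 0)"
    using link[of 0 1] link[of 0 2] by simp_all
  have "c0 ?e1 \<in> {1..\<Delta>}" "c0 ?e2 \<in> {1..\<Delta>}"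
    by (rule proper_edge_coloring_range[OF c0], fact)+
  with same have "c0 ?e1 = c0 ?e2" by blast
  moreover have "c0 ?e1 \<noteq> c0 ?e2"
    by (rule proper_edge_coloring_neq[OF c0 mem, where v = "B * j + 0"])
      (auto simp: doubleton_eq_iff)
  ultimately show False by contradiction
qed

text \<open>Mapping each star edge in \<open>?D\<close> to its block hits all \<open>m\<close>
  blocks, so there are at least \<open>m\<close> disagreements.\<close>

lemma total_recourse_stars_links_ge:
  assumes \<Delta>: "\<Delta> \<ge> 3" and B: "B = 2 * \<Delta> + 1"
    and A: "maintains_coloring {..<B * m} \<Delta> A"
  shows "m \<le> total_recourse A (stars B m @ links B m 1) + total_recourse A (stars B m @ links B m 0)"
proof -
  let ?l = "\<lambda>q. stars B m @ links B m q"
  let ?D = "{f \<in> set (stars B m). A (?l 1) f \<noteq> A (?l 0) f}"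
  have proper: "proper_edge_coloring \<Delta> (set (?l q)) (A (?l q))" if "q \<le> 1" for q
    using A incremental_forest_stars_links[OF \<Delta> that B, of m]
    unfolding maintains_coloring_def by blast
  have "j \<in> (\<lambda>f. Min f div B) ` ?D" if j: "j < m" for j
  proof -
    obtain f s where f: "f \<in> star \<Delta> j s" "s = 1 \<or> s = 2" "A (?l 1) f \<noteq> A (?l 0) f"
      using final_colorings_disagree[OF \<Delta> B j proper proper] by auto
    then have "f \<in> ?D" using star_subset_stars[OF j f(2) B] by auto
    moreover have "j = Min f div B" using Min_star_div[OF f(1,2)] by (simp add: B)
    ultimately show ?thesis by blast
  qed
  then have "{..<m} \<subseteq> (\<lambda>f. Min f div B) ` ?D" by auto
  then have "card {..<m} \<le> card ((\<lambda>f. Min f div B) ` ?D)"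
    by (intro card_mono) auto
  also have "\<dots> \<le> card ?D" by (intro card_image_le) auto
  also have "\<dots> \<le> total_recourse A (?l 1) + total_recourse A (?l 0)"
    by (rule card_disagreement_le_total_recourse)
  finally show ?thesis by simp
qed

theorem theorem2p11:
  "\<exists>c::real. c > 0 \<and>
     (\<forall>\<Delta>::nat. \<Delta> \<ge> 3 \<longrightarrow>
       (\<forall>N::nat. \<exists>(n::nat) (D :: nat edge list pmf).
          (\<forall>es\<in>set_pmf D. incremental_forest {..<n} \<Delta> es \<and> N \<le> length es) \<and>
          (\<forall>M :: nat algorithm measure. randomized_algorithm {..<n} \<Delta> M \<longrightarrow>
             expected_amortized_recourse D M \<ge> c / real \<Delta>)))"
proof (intro exI[of _ "1 / 6"] conjI allI impI)
  show "(0::real) < 1 / 6" by simp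
next
  fix \<Delta> N :: nat
  assume \<Delta>: "\<Delta> \<ge> 3"
  define B where B: "B = 2 * \<Delta> + 1"
  \<comment> \<open>At least one edge per pair gives length at least \<open>N\<close>; the successor
    keeps \<open>m\<close> positive, so that it cancels from the ratio.\<close>
  define m where "m = Suc N"
  have m_pos: "m > 0" by (simp add: m_def)
  define es where "es b = stars B m @ links B m (of_bool b)" for b
  have len_ge: "m \<le> length (es b)" for b
    using length_stars_ge[of B m] \<Delta> by (simp add: es_def B)
  have len_le: "length (es b) \<le> B * m" for b
    unfolding es_def by (rule length_stars_links_le)
  have forest: "incremental_forest {..<B * m} \<Delta> (es b)" for b
    unfolding es_def by (rule incremental_forest_stars_links[OF \<Delta> _ B]) simp
  have bound: "1 / 6 / real \<Delta> \<le> expected_amortized_recourse (map_pmf es (bernoulli_pmf (1/2))) M"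
    if M: "randomized_algorithm {..<B * m} \<Delta> M" for M
  proof -
    \<comment> \<open>The constant comes from 2 * B = 4 * \<Delta> + 2 \<le> 6 * \<Delta>.\<close>
    have "1 / 6 / real \<Delta> \<le> 1 / (2 * real B)"
      using \<Delta> by (simp add: B field_simps)
    also have "\<dots> = real m / (2 * real (B * m))"
      using m_pos by (simp add: field_simps)
    also have "\<dots> \<le> expected_amortized_recourse (map_pmf es (bernoulli_pmf (1/2))) M"
    proof (rule expected_amortized_recourse_coin_ge[OF M])
      show "m \<le> total_recourse A (es True) + total_recourse A (es False)"
        if "maintains_coloring {..<B * m} \<Delta> A" for A
        using total_recourse_stars_links_ge[OF \<Delta> B that] by (simp add: es_def)
      show "0 < length (es b)" for b
        using len_ge[of b] m_pos by linarith
      show "0 < B * m"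
        using m_pos by (simp add: B)
    qed (rule len_le)
    finally show ?thesis .
  qed
  show "\<exists>n D. (\<forall>es\<in>set_pmf D. incremental_forest {..<n} \<Delta> es \<and> N \<le> length es) \<and>
      (\<forall>M :: nat algorithm measure. randomized_algorithm {..<n} \<Delta> M \<longrightarrow>
         1 / 6 / real \<Delta> \<le> expected_amortized_recourse D M)"
  proof (intro exI[of _ "B * m"] exI[of _ "map_pmf es (bernoulli_pmf (1/2))"] conjI ballI allI impI)
    fix l assume "l \<in> set_pmf (map_pmf es (bernoulli_pmf (1/2)))"
    then obtain b where "l = es b" by auto
    then show "incremental_forest {..<B * m} \<Delta> l" "N \<le> length l"
      using forest len_ge[of b] by (simp_all add: m_def)
  qed (rule bound)
qed

end
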